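(* There exists a (finite invertible) $4$-state automaton over the alphabet $\{1,2\}$ such that the group generated by this automaton contains the first Grigorchuk group as a subgroup of infinite index and such that its closure in $\mathrm{Aut}(T)$, where $T$ is the binary rooted tree, equals the closure of the first Grigorchuk group.
   Context: $T$ is the binary rooted tree with vertices the finite words over $X=\{1,2\}$; $\mathrm{Aut}(T)$ is the group of root- and adjacency-preserving bijections of $T$, acting on the left, a profinite group with the pointwise stabilizers of the levels as a base of neighborhoods of the identity. For $g\in\mathrm{Aut}(T)$ and a vertex $v$, the section $g|_v$ is defined by $g(vw)=g(v)\,g|_v(w)$. We write $g=(g_1,g_2)\tau$ if $g|_i=g_i$ and $g$ acts on the first level as $\tau\in\mathrm{Sym}(2)$ ($\tau$ omitted if trivial); $\sigma$ is the non-trivial element of $\mathrm{Sym}(2)$. The first Grigorchuk group is generated by $a=(1,1)\sigma$, $b=(a,c)$, $c=(a,d)$, $d=(1,b)$. An automaton is a tuple $(Q,X,\tau)$ with $\tau:Q\times X\to X\times Q$; it is invertible if for each $q\in Q$ the first component of $\tau(q,\cdot)$ is a permutation of $X$. Each state $q$ defines $g_q\in\mathrm{Aut}(T)$ by $g_q(xw)=y\,g_{q'}(w)$ where $\tau(q,x)=(y,q')$, and the group generated by the automaton is $\langle g_q: q\in Q\rangle$. *)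

theory Defs
  imports "HOL-Algebra.Generated_Groups" "HOL-Analysis.Abstract_Topology"
begin

section \<open>The binary rooted tree and its automorphism group\<close>

datatype letter = One | Two

lemma UNIV_letter: "UNIV = {One, Two}"
  by (auto intro: letter.exhaust)

type_synonym vertex = "letter list"

definition adjacent :: "vertex \<Rightarrow> vertex \<Rightarrow> bool" where
  "adjacent u v \<longleftrightarrow> (\<exists>x. v = u @ [x] \<or> u = v @ [x])"

definition tree_auts :: "(vertex \<Rightarrow> vertex) set" where
  "tree_auts = {g. bij g \<and> g [] = [] \<and> (\<forall>u v. adjacent (g u) (g v) \<longleftrightarrow> adjacent u v)}"

definition AutT :: "(vertex \<Rightarrow> vertex) monoid" where
  "AutT = \<lparr>carrier = tree_auts, mult = (\<circ>), one = id\<rparr>"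

lemma AutT_simps [simp]:
  "carrier AutT = tree_auts" "g \<otimes>\<^bsub>AutT\<^esub> h = g \<circ> h" "\<one>\<^bsub>AutT\<^esub> = id"
  by (simp_all add: AutT_def)

lemma group_AutT: "group AutT"
proof (rule groupI)
  fix g assume "g \<in> carrier AutT"
  then have g: "bij g" "g [] = []" "\<And>u v. adjacent (g u) (g v) \<longleftrightarrow> adjacent u v"
    by (auto simp: tree_auts_def)
  have r: "g (inv_into UNIV g u) = u" for u
    using g(1) by (simp add: bij_is_surj surj_f_inv_f)
  have l: "inv_into UNIV g (g u) = u" for u
    using g(1) by (simp add: bij_is_inj)
  have "inv_into UNIV g \<in> tree_auts"
    unfolding tree_auts_def
    using bij_imp_bij_inv[OF g(1)] l[of "[]"] g(2) g(3)[of "inv_into UNIV g u" "inv_into UNIV g v" for u v]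
    by (auto simp: r)
  moreover have "inv_into UNIV g \<circ> g = id"
    by (simp add: fun_eq_iff l)
  ultimately show "\<exists>h\<in>carrier AutT. h \<otimes>\<^bsub>AutT\<^esub> g = \<one>\<^bsub>AutT\<^esub>"
    by auto
qed (auto simp: tree_auts_def bij_comp comp_assoc)

subsection \<open>The profinite topology\<close>

definition level_stabilizer :: "nat \<Rightarrow> (vertex \<Rightarrow> vertex) set" where
  "level_stabilizer n = {g \<in> tree_auts. \<forall>w. length w = n \<longrightarrow> g w = w}"

text \<open>The group topology on the automorphism group for which the level stabilizers form a base of
  neighbourhoods of the identity: a set is open iff with each point it contains a left translate
  of some level stabilizer.\<close>

definition aut_topology :: "(vertex \<Rightarrow> vertex) topology" where
  "aut_topology = topology (\<lambda>U. U \<subseteq> carrier AutT \<and>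
     (\<forall>g\<in>U. \<exists>n. g <#\<^bsub>AutT\<^esub> level_stabilizer n \<subseteq> U))"

section \<open>The first Grigorchuk group\<close>

fun swap_letter :: "letter \<Rightarrow> letter" where
  "swap_letter One = Two"
| "swap_letter Two = One"

text \<open>The element \<open>(g\<^sub>1, g\<^sub>2)s\<close> with sections \<open>g\<^sub>1\<close>, \<open>g\<^sub>2\<close> at the vertices of the first level, acting
  as \<open>s\<close> on the first level.\<close>

fun wreath :: "(vertex \<Rightarrow> vertex) \<Rightarrow> (vertex \<Rightarrow> vertex) \<Rightarrow> (letter \<Rightarrow> letter) \<Rightarrow> vertex \<Rightarrow> vertex" where
  "wreath g1 g2 s [] = []"
| "wreath g1 g2 s (One # w) = s One # g1 w"
| "wreath g1 g2 s (Two # w) = s Two # g2 w"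

definition grig_a :: "vertex \<Rightarrow> vertex" where
  "grig_a = wreath id id swap_letter"

text \<open>The wreath recursion determines the three functions uniquely, by recursion on words;
  see \<open>grig_wreath\<close> below.\<close>

fun grig_b grig_c grig_d :: "vertex \<Rightarrow> vertex" where
  "grig_b [] = []"
| "grig_b (One # w) = One # grig_a w"
| "grig_b (Two # w) = Two # grig_c w"
| "grig_c [] = []"
| "grig_c (One # w) = One # grig_a w"
| "grig_c (Two # w) = Two # grig_d w"
| "grig_d [] = []"
| "grig_d (One # w) = One # w"
| "grig_d (Two # w) = Two # grig_b w"

lemma grig_wreath:
  "grig_b = wreath grig_a grig_c id"
  "grig_c = wreath grig_a grig_d id"
  "grig_d = wreath id grig_b id"
proof -
  have "grig_b w = wreath grig_a grig_c id w" "grig_c w = wreath grig_a grig_d id w"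
    "grig_d w = wreath id grig_b id w" for w
    by (cases "(grig_a, grig_c, id :: letter \<Rightarrow> letter, w)" rule: wreath.cases; simp)+
  then show "grig_b = wreath grig_a grig_c id" "grig_c = wreath grig_a grig_d id"
    "grig_d = wreath id grig_b id"
    by blast+
qed

definition grigorchuk_group :: "(vertex \<Rightarrow> vertex) set" where
  "grigorchuk_group = generate AutT {grig_a, grig_b, grig_c, grig_d}"

section \<open>Automata over the binary alphabet\<close>

record 'q automaton =
  states :: "'q set"
  trans :: "'q \<times> letter \<Rightarrow> letter \<times> 'q"

definition is_automaton :: "'q automaton \<Rightarrow> bool" where
  "is_automaton A \<longleftrightarrow> trans A \<in> states A \<times> UNIV \<rightarrow> UNIV \<times> states A"

definition invertible_automaton :: "'q automaton \<Rightarrow> bool" where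
  "invertible_automaton A \<longleftrightarrow> is_automaton A \<and> (\<forall>q\<in>states A. bij (\<lambda>x. fst (trans A (q, x))))"

fun state_action :: "'q automaton \<Rightarrow> 'q \<Rightarrow> vertex \<Rightarrow> vertex" where
  "state_action A q [] = []"
| "state_action A q (x # w) = (case trans A (q, x) of (y, q') \<Rightarrow> y # state_action A q' w)"

definition automaton_group :: "'q automaton \<Rightarrow> (vertex \<Rightarrow> vertex) set" where
  "automaton_group A = generate AutT (state_action A ` states A)"

section \<open>Well-definedness\<close>

lemma istopology_aut:
  "istopology (\<lambda>U. U \<subseteq> carrier AutT \<and> (\<forall>g\<in>U. \<exists>n. g <#\<^bsub>AutT\<^esub> level_stabilizer n \<subseteq> U))"
proof -
  have mono: "level_stabilizer n \<subseteq> level_stabilizer m" if "m \<le> n" for m n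
  proof
    fix g assume g: "g \<in> level_stabilizer n"
    have "g w = w" if "length w = m" for w
    proof -
      have fix_all: "g u = u" if "length u \<le> n" for u
        using that
      proof (induction u rule: measure_induct_rule[where f = "\<lambda>u. n - length u"])
        case (less u)
        show ?case
        proof (cases "length u = n")
          case True
          then show ?thesis using g by (simp add: level_stabilizer_def)
        next
          case False
          then have lt: "length u < n" using less.prems by simp
          have ch: "g (u @ [x]) = u @ [x]" for x
            using less.IH[of "u @ [x]"] lt by simp
          have adj: "adjacent (g u) (u @ [x])" for x
            using g ch[of x] unfolding level_stabilizer_def tree_auts_def adjacent_def
            by (smt (verit) mem_Collect_eq)
          from adj[of One] adj[of Two] show ?thesis
            unfolding adjacent_def by auto
        qed
      qed
      then show ?thesis using that \<open>m \<le> n\<close> by simp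
    qed
    then show "g \<in> level_stabilizer m"
      using g by (simp add: level_stabilizer_def)
  qed
  have coset_mono: "g <#\<^bsub>AutT\<^esub> level_stabilizer n \<subseteq> g <#\<^bsub>AutT\<^esub> level_stabilizer m" if "m \<le> n" for g m n
    using mono[OF that] by (auto simp: l_coset_def)
  show ?thesis
    unfolding istopology_def
  proof (intro conjI allI impI ballI)
    fix S T g
    assume S: "S \<subseteq> carrier AutT \<and> (\<forall>g\<in>S. \<exists>n. g <#\<^bsub>AutT\<^esub> level_stabilizer n \<subseteq> S)"
      and T: "T \<subseteq> carrier AutT \<and> (\<forall>g\<in>T. \<exists>n. g <#\<^bsub>AutT\<^esub> level_stabilizer n \<subseteq> T)"
      and g: "g \<in> S \<inter> T"
    then obtain m n where "g <#\<^bsub>AutT\<^esub> level_stabilizer m \<subseteq> S" "g <#\<^bsub>AutT\<^esub> level_stabilizer n \<subseteq> T"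
      by blast
    then show "\<exists>n. g <#\<^bsub>AutT\<^esub> level_stabilizer n \<subseteq> S \<inter> T"
      using coset_mono[of m "max m n" g] coset_mono[of n "max m n" g]
      by (intro exI[of _ "max m n"]) auto
  next
    fix \<K> g
    assume K: "\<forall>K\<in>\<K>. K \<subseteq> carrier AutT \<and> (\<forall>g\<in>K. \<exists>n. g <#\<^bsub>AutT\<^esub> level_stabilizer n \<subseteq> K)"
      and "g \<in> \<Union>\<K>"
    then obtain K where "K \<in> \<K>" "g \<in> K" by blast
    moreover from this K obtain n where "g <#\<^bsub>AutT\<^esub> level_stabilizer n \<subseteq> K" by blast
    ultimately show "\<exists>n. g <#\<^bsub>AutT\<^esub> level_stabilizer n \<subseteq> \<Union>\<K>" by blast
  qed (simp_all only: Union_least le_infI1)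
qed

lemma openin_aut_topology:
  "openin aut_topology U \<longleftrightarrow>
     U \<subseteq> carrier AutT \<and> (\<forall>g\<in>U. \<exists>n. g <#\<^bsub>AutT\<^esub> level_stabilizer n \<subseteq> U)"
  unfolding aut_topology_def topology_inverse'[OF istopology_aut] ..

lemma topspace_aut_topology: "topspace aut_topology = carrier AutT"
proof (rule antisym)
  show "topspace aut_topology \<subseteq> carrier AutT"
    using openin_aut_topology openin_topspace by blast
  have "openin aut_topology (carrier AutT)"
    unfolding openin_aut_topology
  proof (intro conjI ballI exI)
    fix g assume "g \<in> carrier AutT"
    moreover have "level_stabilizer 0 \<subseteq> carrier AutT"
      by (auto simp: level_stabilizer_def)
    ultimately show "g <#\<^bsub>AutT\<^esub> level_stabilizer 0 \<subseteq> carrier AutT"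
      by (intro group.l_coset_subset_G[OF group_AutT])
  qed simp
  then show "carrier AutT \<subseteq> topspace aut_topology"
    by (rule openin_subset)
qed

lemma tree_autsI:
  assumes "bij g" "\<And>w. length (g w) = length w" "\<And>w x. \<exists>y. g (w @ [x]) = g w @ [y]"
  shows "g \<in> tree_auts"
proof -
  have child: "(\<exists>y. g v = g u @ [y]) \<longleftrightarrow> (\<exists>x. v = u @ [x])" for u v
  proof
    assume "\<exists>y. g v = g u @ [y]"
    then obtain y where y: "g v = g u @ [y]" ..
    then have "v \<noteq> []" using assms(2)[of v] by auto
    then obtain v' x where v: "v = v' @ [x]" by (metis rev_exhaust)
    then have "g v' = g u" using assms(3)[of v' x] y by auto
    then have "v' = u" using assms(1) by (simp add: bij_is_inj inj_eq)
    then show "\<exists>x. v = u @ [x]" using v by blast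
  qed (use assms(3) in auto)
  have "g [] = []" using assms(2)[of "[]"] by simp
  moreover have "adjacent (g u) (g v) \<longleftrightarrow> adjacent u v" for u v
    unfolding adjacent_def ex_disj_distrib child ..
  ultimately show ?thesis using assms(1) by (simp add: tree_auts_def)
qed

lemma state_action_in_AutT:
  assumes A: "invertible_automaton A" and "q \<in> states A"
  shows "state_action A q \<in> carrier AutT"
proof -
  have len: "length (state_action A q w) = length w" for q w
    by (induction w arbitrary: q) (auto split: prod.splits)
  have step: "snd (trans A (q, x)) \<in> states A" if "q \<in> states A" for q x
    using A that by (auto simp: invertible_automaton_def is_automaton_def Pi_iff mem_Times_iff)
  have perm: "bij (\<lambda>x. fst (trans A (q, x)))" if "q \<in> states A" for q
    using A that by (simp add: invertible_automaton_def)
  have child: "\<exists>y. state_action A q (w @ [x]) = state_action A q w @ [y]" for q w x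
    by (induction w arbitrary: q) (auto split: prod.splits)
  have inj: "v = w" if "q \<in> states A" "state_action A q v = state_action A q w" for q v w
    using that
  proof (induction v arbitrary: q w)
    case Nil
    then show ?case using len[of q w] by simp
  next
    case (Cons x v)
    then obtain y w' where w: "w = y # w'"
      using len[of q "x # v"] len[of q w] by (cases w) auto
    have "fst (trans A (q, x)) = fst (trans A (q, y))"
      using Cons.prems(2) by (simp add: w split: prod.splits)
    then have "x = y" using perm[OF Cons.prems(1)] by (simp add: bij_def inj_def)
    then show ?case
      using Cons.prems(2) Cons.IH[OF step[OF Cons.prems(1), of x], of w']
      by (simp add: w split: prod.splits)
  qed
  have surj: "\<exists>v. state_action A q v = w" if "q \<in> states A" for q w
    using that
  proof (induction w arbitrary: q)
    case Nil
    then show ?case by (intro exI[of _ "[]"]) simp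
  next
    case (Cons y w)
    obtain x where x: "fst (trans A (q, x)) = y"
      using surjD[OF bij_is_surj[OF perm[OF Cons.prems]], of y] by auto
    obtain v where v: "state_action A (snd (trans A (q, x))) v = w"
      using Cons.IH[OF step[OF Cons.prems]] by blast
    have "state_action A q (x # v) = y # w"
      using x v by (simp add: case_prod_beta)
    then show ?case ..
  qed
  have "bij (state_action A q)"
    unfolding bij_def
  proof
    show "inj (state_action A q)"
      by (rule injI) (rule inj[OF assms(2)])
    show "surj (state_action A q)"
      unfolding surj_def using surj[OF assms(2)] by (simp add: eq_commute)
  qed
  then show ?thesis using len child by (simp add: tree_autsI)
qed

lemma automaton_group_subgroup:
  "invertible_automaton A \<Longrightarrow> subgroup (automaton_group A) AutT"
  unfolding automaton_group_def
  by (rule group.generate_is_subgroup[OF group_AutT]) (use state_action_in_AutT in auto)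

lemma grig_in_AutT: "{grig_a, grig_b, grig_c, grig_d} \<subseteq> carrier AutT"
proof -
  have inv_a: "grig_a (grig_a w) = w" for w
    by (cases "(id :: vertex \<Rightarrow> vertex, id :: vertex \<Rightarrow> vertex, id :: letter \<Rightarrow> letter, w)"
        rule: wreath.cases) (auto simp: grig_a_def)
  have nil_a: "grig_a [] = []"
    by (simp add: grig_a_def)
  have len_a: "length (grig_a w) = length w" for w
    by (cases "(id :: vertex \<Rightarrow> vertex, id :: vertex \<Rightarrow> vertex, id :: letter \<Rightarrow> letter, w)"
        rule: wreath.cases) (auto simp: grig_a_def)
  have child_a: "\<exists>y. grig_a (w @ [x]) = grig_a w @ [y]" for w x
    by (cases "(id :: vertex \<Rightarrow> vertex, id :: vertex \<Rightarrow> vertex, id :: letter \<Rightarrow> letter, w)"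
        rule: wreath.cases; cases x) (auto simp: grig_a_def)
  have inv_bcd: "grig_b (grig_b w) = w" "grig_c (grig_c w) = w" "grig_d (grig_d w) = w" for w
    by (induction w and w and w rule: grig_b_grig_c_grig_d.induct) (simp_all add: inv_a)
  have len_bcd: "length (grig_b w) = length w" "length (grig_c w) = length w"
    "length (grig_d w) = length w" for w
    by (induction w and w and w rule: grig_b_grig_c_grig_d.induct) (simp_all add: len_a)
  have single: "\<exists>y. grig_b [x] = [y]" "\<exists>y. grig_c [x] = [y]" "\<exists>y. grig_d [x] = [y]" for x
    by (cases x; simp add: nil_a)+
  have child_bcd: "\<exists>y. grig_b (w @ [x]) = grig_b w @ [y]" "\<exists>y. grig_c (w @ [x]) = grig_c w @ [y]"
    "\<exists>y. grig_d (w @ [x]) = grig_d w @ [y]" for w x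
    by (induction w and w and w rule: grig_b_grig_c_grig_d.induct)
      (simp_all add: child_a single)
  have "bij g" if "\<And>w. g (g w) = w" for g :: "vertex \<Rightarrow> vertex"
    using that by (rule involuntory_imp_bij)
  then show ?thesis
    using inv_a len_a child_a inv_bcd len_bcd child_bcd by (auto intro!: tree_autsI)
qed

lemma grigorchuk_group_subgroup: "subgroup grigorchuk_group AutT"
  unfolding grigorchuk_group_def
  by (rule group.generate_is_subgroup[OF group_AutT grig_in_AutT])

end

theory Submission
  imports Defs
begin

text \<open>The automaton has the states \<open>t\<close>, \<open>bt\<close>, \<open>abt\<close>, \<open>dt\<close> where \<open>t = (bt, bt)\<close>; then \<open>bt = (abt, dt)\<close>,
  \<open>abt = (abt, dt)\<sigma>\<close> and \<open>dt = (bt, t)\<close>, and the group generated is \<open>\<langle>a, b, c, d, t\<rangle>\<close>.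

  Closure: if \<open>g\<close> in the Grigorchuk group \<open>G\<close> agrees with \<open>t\<close> on level \<open>n\<close>, then \<open>(bg, bg)\<close> agrees
  with \<open>t\<close> on level \<open>n + 1\<close>; choosing \<open>g\<close> suitably, \<open>(bg, bg)\<close> is again in \<open>G\<close> and of the same kind.

  Infinite index: let \<open>P\<close> be the subgroup of all \<open>h\<close> that fix the vertex \<open>222\<close> and equal their section
  there. As \<open>G\<close> is contracting with nucleus \<open>{1, a, b, c, d}\<close>, \<open>P \<inter> G\<close> lies in the nucleus, so each
  coset of \<open>G\<close> meets \<open>P\<close> in at most five elements. But \<open>P\<close> is infinite: it contains \<open>b\<close> and \<open>t\<close>, hence
  its second level sections contain \<open>abt\<close> and \<open>dt\<close> up to conjugation, and a group with
  conjugates of these two elements properly covers, two levels further down, another such group.\<close>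

section \<open>Calculation rules for the automorphism group\<close>

interpretation AutT: group AutT
  by (rule group_AutT)

lemmas AutT_inv [simp] =
  AutT.inv_closed[simplified] AutT.l_inv[simplified] AutT.r_inv[simplified]

lemma tree_auts_comp [simp]: "g \<in> tree_auts \<Longrightarrow> h \<in> tree_auts \<Longrightarrow> g \<circ> h \<in> tree_auts"
  using AutT.m_closed by simp

lemma tree_auts_id [simp]: "id \<in> tree_auts"
  using AutT.one_closed by simp

lemma AutT_inv_apply [simp]:
  assumes "g \<in> tree_auts"
  shows "(inv\<^bsub>AutT\<^esub> g) (g w) = w" "g ((inv\<^bsub>AutT\<^esub> g) w) = w"
  using AutT_inv(2,3)[OF assms] by (metis comp_apply id_apply)+

lemma AutT_inv_unique: "g \<in> tree_auts \<Longrightarrow> h \<in> tree_auts \<Longrightarrow> h \<circ> g = id \<Longrightarrow> inv\<^bsub>AutT\<^esub> g = h"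
  using AutT.inv_equality by simp

section \<open>Sections of tree automorphisms\<close>

text \<open>The image of a child of \<open>w @ [z]\<close> is adjacent to the image of
  \<open>w @ [z]\<close>. By injectivity it is not \<open>g w\<close>, the vertex above, so it lies
  one level further down.\<close>

lemma tree_auts_child:
  assumes "g \<in> tree_auts"
  shows "length (g w) = length w \<and> (\<exists>y. g (w @ [x]) = g w @ [y])"
proof (induction w arbitrary: x rule: rev_induct)
  case Nil
  have "adjacent (g []) (g ([] @ [x]))"
    using assms unfolding tree_auts_def adjacent_def by blast
  then show ?case
    using assms by (auto simp: tree_auts_def adjacent_def)
next
  case (snoc z w)
  obtain y where y: "g (w @ [z]) = g w @ [y]"
    using snoc by blast
  have "adjacent (g (w @ [z])) (g ((w @ [z]) @ [x]))"
    using assms unfolding tree_auts_def adjacent_def by blast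
  moreover have "g ((w @ [z]) @ [x]) \<noteq> g w"
    using assms by (auto simp: tree_auts_def bij_def dest: injD)
  ultimately have "\<exists>y'. g ((w @ [z]) @ [x]) = g (w @ [z]) @ [y']"
    unfolding y adjacent_def by auto
  then show ?case
    using snoc y by auto
qed

lemma tree_auts_length [simp]: "g \<in> tree_auts \<Longrightarrow> length (g w) = length w"
  using tree_auts_child by blast

definition root_perm :: "(vertex \<Rightarrow> vertex) \<Rightarrow> letter \<Rightarrow> letter" where
  "root_perm g x = hd (g [x])"

definition sect :: "letter \<Rightarrow> (vertex \<Rightarrow> vertex) \<Rightarrow> vertex \<Rightarrow> vertex" where
  "sect x g w = tl (g (x # w))"

lemma tree_auts_Cons:
  assumes "g \<in> tree_auts"
  shows "g (x # w) = root_perm g x # sect x g w"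
proof -
  have "\<exists>u. g (x # w) = root_perm g x # u"
  proof (induction w rule: rev_induct)
    case Nil
    have "length (g [x]) = 1"
      using assms by simp
    then show ?case
      by (cases "g [x]") (auto simp: root_perm_def)
  next
    case (snoc z w)
    then show ?case
      using tree_auts_child[OF assms, of "x # w" z] by auto
  qed
  then show ?thesis
    by (auto simp: sect_def)
qed

lemma root_perm_sect_eqI:
  assumes "\<And>w. g (x # w) = y # h w"
  shows "root_perm g x = y" "sect x g = h"
  using assms by (auto simp: root_perm_def sect_def)

lemma sect_comp:
  assumes "g \<in> tree_auts" "h \<in> tree_auts"
  shows "root_perm (g \<circ> h) x = root_perm g (root_perm h x)"
    and "sect x (g \<circ> h) = sect (root_perm h x) g \<circ> sect x h"
  by (rule root_perm_sect_eqI; simp add: tree_auts_Cons[OF assms(1)] tree_auts_Cons[OF assms(2)])+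

lemma sect_id [simp]: "root_perm id x = x" "sect x id = id"
  by (rule root_perm_sect_eqI; simp)+

lemma root_perm_inv:
  assumes "g \<in> tree_auts"
  shows "root_perm (inv\<^bsub>AutT\<^esub> g) (root_perm g x) = x"
    and "root_perm g (root_perm (inv\<^bsub>AutT\<^esub> g) x) = x"
  using assms by (metis AutT_inv(1,2) sect_comp(1) sect_id(1), metis AutT_inv(1,3) sect_comp(1) sect_id(1))

lemma sect_inv_comp:
  assumes "g \<in> tree_auts" "root_perm g x = y"
  shows "sect y (inv\<^bsub>AutT\<^esub> g) \<circ> sect x g = id" "sect x g \<circ> sect y (inv\<^bsub>AutT\<^esub> g) = id"
proof -
  show "sect y (inv\<^bsub>AutT\<^esub> g) \<circ> sect x g = id"
    using sect_comp(2)[of "inv\<^bsub>AutT\<^esub> g" g x] assms by simp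
  have "root_perm (inv\<^bsub>AutT\<^esub> g) y = x"
    using root_perm_inv(1) assms by blast
  then show "sect x g \<circ> sect y (inv\<^bsub>AutT\<^esub> g) = id"
    using sect_comp(2)[of g "inv\<^bsub>AutT\<^esub> g" y] assms by simp
qed

lemma sect_in_tree_auts [simp]:
  assumes "g \<in> tree_auts"
  shows "sect x g \<in> tree_auts"
proof (rule tree_autsI)
  show "bij (sect x g)"
    using sect_inv_comp[OF assms refl] by (rule o_bij)
  show "length (sect x g w) = length w" for w
    using assms by (simp add: sect_def)
  fix w z
  show "\<exists>y. sect x g (w @ [z]) = sect x g w @ [y]"
    using tree_auts_child[OF assms, of "x # w" z] by (auto simp: tree_auts_Cons[OF assms])
qed

lemma sect_inv:
  assumes "g \<in> tree_auts" "root_perm g x = y"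
  shows "sect y (inv\<^bsub>AutT\<^esub> g) = inv\<^bsub>AutT\<^esub> (sect x g)"
  using AutT_inv_unique[OF _ _ sect_inv_comp(1)[OF assms]] assms by simp

lemma root_perm_neq: "g \<in> tree_auts \<Longrightarrow> root_perm g One \<noteq> root_perm g Two"
  by (metis letter.distinct(1) root_perm_inv(1))

section \<open>Vertex stabilizers and finite subgroups\<close>

definition sect_grp :: "(vertex \<Rightarrow> vertex) set \<Rightarrow> (vertex \<Rightarrow> vertex) set" where
  "sect_grp R = sect One ` {g \<in> R. root_perm g One = One}"

text \<open>The conjugator ranges over all of \<open>tree_auts\<close>: its section, which
  conjugates one level down, need not lie in \<open>sect_grp R\<close> even if the conjugator lies
  in \<open>R\<close>.\<close>

definition conj_in :: "(vertex \<Rightarrow> vertex) set \<Rightarrow> (vertex \<Rightarrow> vertex) \<Rightarrow> bool" where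
  "conj_in R r \<longleftrightarrow> (\<exists>x\<in>tree_auts. x \<circ> r \<circ> inv\<^bsub>AutT\<^esub> x \<in> R)"

lemma subgroup_AutT_iff:
  "subgroup R AutT \<longleftrightarrow> R \<subseteq> tree_auts \<and> id \<in> R \<and> (\<forall>g\<in>R. \<forall>h\<in>R. g \<circ> h \<in> R) \<and> (\<forall>g\<in>R. inv\<^bsub>AutT\<^esub> g \<in> R)"
  by (auto simp: subgroup_def)

lemma conj_inI: "subgroup R AutT \<Longrightarrow> g \<in> R \<Longrightarrow> conj_in R g"
  unfolding conj_in_def using AutT.inv_one by (intro bexI[of _ id]) auto

lemma sect_grp_subgroup:
  assumes "subgroup R AutT"
  shows "subgroup (sect_grp R) AutT"
proof -
  note R = assms[unfolded subgroup_AutT_iff]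
  have "id \<in> sect_grp R"
    using R sect_id by (force simp: sect_grp_def)
  moreover have "sect One g \<circ> sect One h \<in> sect_grp R"
    if "g \<in> R" "h \<in> R" "root_perm g One = One" "root_perm h One = One" for g h
    using that R sect_comp[of g h One] unfolding sect_grp_def by (metis (mono_tags, lifting) image_eqI mem_Collect_eq subsetD)
  moreover have "inv\<^bsub>AutT\<^esub> (sect One g) \<in> sect_grp R"
    if "g \<in> R" "root_perm g One = One" for g
    using that R sect_inv[of g One One] root_perm_inv(1)[of g One]
    unfolding sect_grp_def by (metis (mono_tags, lifting) image_eqI mem_Collect_eq subsetD)
  ultimately show ?thesis
    using R unfolding subgroup_AutT_iff by (auto simp: sect_grp_def)
qed

lemma finite_sect_grp: "finite R \<Longrightarrow> finite (sect_grp R)"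
  by (simp add: sect_grp_def)

text \<open>\<open>g\<close> lies outside the stabilizer of \<open>One\<close>, and taking sections
  cannot increase the cardinality. This strict drop drives the descent in
  \<open>infinite_if_conj_in\<close>.\<close>

lemma card_sect_grp_less:
  assumes "finite R" "g \<in> R" "root_perm g One = Two"
  shows "card (sect_grp R) < card R"
proof -
  have "card (sect_grp R) \<le> card {g \<in> R. root_perm g One = One}"
    unfolding sect_grp_def using assms(1) by (intro card_image_le) simp
  also have "\<dots> < card R"
    by (rule psubset_card_mono) (use assms in force)+
  finally show ?thesis .
qed

text \<open>With only two letters, moving \<open>One\<close> means acting nontrivially on the first
  level, a property that conjugation preserves.\<close>

lemma root_perm_conj:
  assumes "x \<in> tree_auts" "r \<in> tree_auts" "root_perm r One = Two"
  shows "root_perm (x \<circ> r \<circ> inv\<^bsub>AutT\<^esub> x) One = Two"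
proof -
  let ?z = "root_perm (inv\<^bsub>AutT\<^esub> x) One"
  have "root_perm r ?z \<noteq> ?z"
    using root_perm_neq[OF assms(2)] assms(3) by (metis letter.exhaust)
  then have "root_perm x (root_perm r ?z) \<noteq> root_perm x ?z"
    using root_perm_inv(1)[OF assms(1)] by metis
  moreover have "root_perm x ?z = One"
    using root_perm_inv(2)[OF assms(1)] .
  ultimately show ?thesis
    using assms by (simp add: sect_comp) (metis letter.exhaust)
qed

text \<open>If \<open>y\<close> maps \<open>i\<close> to \<open>One\<close>, the conjugate of
  \<open>r\<close> by \<open>y\<close> fixes \<open>One\<close>, and its section there is the
  conjugate of \<open>sect i r\<close> by \<open>sect i y\<close>.\<close>

lemma conj_in_sect_grp:
  assumes R: "subgroup R AutT" and g: "g \<in> R" "root_perm g One = Two"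
    and r: "r \<in> tree_auts" "root_perm r i = i" and conj: "conj_in R r"
  shows "conj_in (sect_grp R) (sect i r)"
proof -
  note R' = R[unfolded subgroup_AutT_iff]
  obtain x where x: "x \<in> tree_auts" "x \<circ> r \<circ> inv\<^bsub>AutT\<^esub> x \<in> R"
    using conj unfolding conj_in_def by blast
  have gT: "g \<in> tree_auts" using g R' by blast
  \<comment> \<open>Conjugating by the active element \<open>g\<close> if necessary, \<open>i\<close> is moved to \<open>One\<close>.\<close>
  obtain y where y: "y \<in> tree_auts" "y \<circ> r \<circ> inv\<^bsub>AutT\<^esub> y \<in> R" "root_perm y i = One"
  proof (cases "root_perm x i")
    case One
    then show ?thesis using that x by blast
  next
    case Two
    have "root_perm g Two = One"
      using root_perm_neq[OF gT] g(2) by (metis letter.exhaust)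
    then have "root_perm (g \<circ> x) i = One"
      using Two x gT by (simp add: sect_comp)
    moreover have "(g \<circ> x) \<circ> r \<circ> inv\<^bsub>AutT\<^esub> (g \<circ> x) = g \<circ> (x \<circ> r \<circ> inv\<^bsub>AutT\<^esub> x) \<circ> inv\<^bsub>AutT\<^esub> g"
      using AutT.inv_mult_group[of g x] gT x by (simp add: comp_assoc)
    moreover have "g \<circ> (x \<circ> r \<circ> inv\<^bsub>AutT\<^esub> x) \<circ> inv\<^bsub>AutT\<^esub> g \<in> R"
      using R' g x by blast
    ultimately show ?thesis using that gT x by (metis tree_auts_comp)
  qed
  have inv1: "root_perm (inv\<^bsub>AutT\<^esub> y) One = i"
    using root_perm_inv(1)[OF y(1), of i] y(3) by simp
  have "root_perm (y \<circ> r \<circ> inv\<^bsub>AutT\<^esub> y) One = One"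
    using y r inv1 by (simp add: sect_comp)
  moreover have "sect One (y \<circ> r \<circ> inv\<^bsub>AutT\<^esub> y) = sect i y \<circ> sect i r \<circ> inv\<^bsub>AutT\<^esub> (sect i y)"
    using y r inv1 by (simp add: sect_comp sect_inv)
  ultimately show ?thesis
    using y unfolding conj_in_def sect_grp_def
    by (intro bexI[of _ "sect i y"]) (auto intro!: image_eqI[of _ _ "y \<circ> r \<circ> inv\<^bsub>AutT\<^esub> y"])
qed

section \<open>The automaton\<close>

text \<open>States \<open>0\<close>, \<open>1\<close>, \<open>2\<close>, \<open>3\<close> act as
  \<open>t\<close>, \<open>bt\<close>, \<open>abt\<close>, \<open>dt\<close>.\<close>

definition ext_automaton :: "nat automaton" where
  "ext_automaton = \<lparr>states = {0, 1, 2, 3}, trans = (\<lambda>(q, x).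
     if q = 0 then (x, 1)
     else if q = 1 then (x, if x = One then 2 else 3)
     else if q = 2 then (swap_letter x, if x = One then 2 else 3)
     else (x, if x = One then 1 else 0))\<rparr>"

lemma invertible_ext_automaton: "invertible_automaton ext_automaton"
proof -
  have "bij swap_letter"
    by (rule involuntory_imp_bij) (metis letter.exhaust swap_letter.simps)
  then show ?thesis
    by (auto simp: invertible_automaton_def is_automaton_def ext_automaton_def bij_id[unfolded id_def])
qed

lemma trans_ext_automaton [simp]:
  "trans ext_automaton (0, x) = (x, 1)"
  "trans ext_automaton (Suc 0, x) = (x, if x = One then 2 else 3)"
  "trans ext_automaton (2, x) = (swap_letter x, if x = One then 2 else 3)"
  "trans ext_automaton (3, x) = (x, if x = One then 1 else 0)"
  by (simp_all add: ext_automaton_def)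

definition grig_t :: "vertex \<Rightarrow> vertex" where
  "grig_t = state_action ext_automaton 0"

lemma grig_a_simps [simp]:
  "grig_a [] = []" "grig_a (One # w) = Two # w" "grig_a (Two # w) = One # w"
  by (simp_all add: grig_a_def)

lemma grig_invol [simp]:
  "grig_a (grig_a w) = w" "grig_b (grig_b w) = w" "grig_c (grig_c w) = w" "grig_d (grig_d w) = w"
proof -
  show *: "grig_a (grig_a w) = w" for w
    by (cases w; cases "hd w") auto
  show "grig_b (grig_b w) = w" "grig_c (grig_c w) = w" "grig_d (grig_d w) = w"
    by (induction w and w and w rule: grig_b_grig_c_grig_d.induct) (simp_all add: *)
qed

text \<open>\<open>1, b, c, d\<close> form a Klein four-group. The induction is joint because the
  section at \<open>Two\<close> of each identity is another one of them.\<close>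

lemma grig_klein [simp]:
  "grig_b (grig_c w) = grig_d w" "grig_c (grig_d w) = grig_b w" "grig_d (grig_b w) = grig_c w"
  "grig_c (grig_b w) = grig_d w" "grig_d (grig_c w) = grig_b w" "grig_b (grig_d w) = grig_c w"
proof -
  have "grig_b (grig_c w) = grig_d w \<and> grig_c (grig_d w) = grig_b w \<and> grig_d (grig_b w) = grig_c w
    \<and> grig_c (grig_b w) = grig_d w \<and> grig_d (grig_c w) = grig_b w \<and> grig_b (grig_d w) = grig_c w"
  proof (induction w)
    case (Cons x w)
    then show ?case by (cases x) auto
  qed simp
  then show "grig_b (grig_c w) = grig_d w" "grig_c (grig_d w) = grig_b w"
    "grig_d (grig_b w) = grig_c w" "grig_c (grig_b w) = grig_d w"
    "grig_d (grig_c w) = grig_b w" "grig_b (grig_d w) = grig_c w"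
    by blast+
qed

text \<open>Multiplying \<open>t = (bt, bt)\<close> by \<open>b = (a, c)\<close> and
  \<open>d = (1, b)\<close>, with \<open>cb = d\<close> and \<open>bb = 1\<close>, gives
  \<open>bt = (abt, dt)\<close> and \<open>dt = (bt, t)\<close>, as in the transition table.\<close>

lemma state_action_ext:
  "state_action ext_automaton 1 = grig_b \<circ> grig_t"
  "state_action ext_automaton 2 = grig_a \<circ> grig_b \<circ> grig_t"
  "state_action ext_automaton 3 = grig_d \<circ> grig_t"
proof -
  have "state_action ext_automaton 1 w = grig_b (grig_t w) \<and>
    state_action ext_automaton 2 w = grig_a (grig_b (grig_t w)) \<and>
    state_action ext_automaton 3 w = grig_d (grig_t w)" for w
  proof (induction w)
    case (Cons x w)
    then show ?case
      by (cases x) (simp_all add: grig_t_def)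
  qed (simp add: grig_t_def)
  then show "state_action ext_automaton 1 = grig_b \<circ> grig_t"
    "state_action ext_automaton 2 = grig_a \<circ> grig_b \<circ> grig_t"
    "state_action ext_automaton 3 = grig_d \<circ> grig_t"
    by (auto simp: fun_eq_iff)
qed

lemma grig_t_simps [simp]: "grig_t [] = []" "grig_t (x # w) = x # grig_b (grig_t w)"
proof -
  show "grig_t [] = []"
    by (simp add: grig_t_def)
  have "grig_t (x # w) = x # state_action ext_automaton 1 w"
    by (simp add: grig_t_def)
  then show "grig_t (x # w) = x # grig_b (grig_t w)"
    by (simp only: state_action_ext comp_apply)
qed

lemma grig_tree_auts [simp]:
  "grig_a \<in> tree_auts" "grig_b \<in> tree_auts" "grig_c \<in> tree_auts" "grig_d \<in> tree_auts"
  "grig_t \<in> tree_auts"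
  using grig_in_AutT state_action_in_AutT[OF invertible_ext_automaton, of 0]
  by (auto simp: grig_t_def ext_automaton_def)

section \<open>Infinite subgroups\<close>

text \<open>Since \<open>bt = (abt, dt)\<close>, its sections at the two letters are the two
  elements wanted; the active \<open>g\<close> makes both letters accessible from
  \<open>One\<close>.\<close>

lemma conj_in_step:
  assumes "subgroup R AutT" "g \<in> R" "root_perm g One = Two" "conj_in R (grig_b \<circ> grig_t)"
  shows "conj_in (sect_grp R) (grig_a \<circ> grig_b \<circ> grig_t)" "conj_in (sect_grp R) (grig_d \<circ> grig_t)"
proof -
  have one: "root_perm (grig_b \<circ> grig_t) One = One"
      "sect One (grig_b \<circ> grig_t) = grig_a \<circ> grig_b \<circ> grig_t"
    and two: "root_perm (grig_b \<circ> grig_t) Two = Two"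
      "sect Two (grig_b \<circ> grig_t) = grig_d \<circ> grig_t"
    by (rule root_perm_sect_eqI; simp)+
  have "grig_b \<circ> grig_t \<in> tree_auts"
    by simp
  from conj_in_sect_grp[OF assms(1-3) this one(1) assms(4)] conj_in_sect_grp[OF assms(1-3) this two(1) assms(4)]
  show "conj_in (sect_grp R) (grig_a \<circ> grig_b \<circ> grig_t)" "conj_in (sect_grp R) (grig_d \<circ> grig_t)"
    unfolding one(2) two(2) .
qed

text \<open>Passing to the sections at \<open>One\<close> twice reproduces the hypothesis in a smaller group.\<close>

lemma infinite_if_conj_in:
  assumes "subgroup R AutT" "conj_in R (grig_a \<circ> grig_b \<circ> grig_t)" "conj_in R (grig_d \<circ> grig_t)"
  shows "infinite R"
proof
  assume "finite R"
  then show False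
    using assms
  proof (induction "card R" arbitrary: R rule: less_induct)
    case less
    let ?u = "grig_a \<circ> grig_b \<circ> grig_t"
    \<comment> \<open>The section of \<open>?u \<circ> ?u\<close> at \<open>One\<close>. It is again
      active at the root, so that the descent can continue one level further.\<close>
    let ?v = "grig_d \<circ> grig_t \<circ> ?u"
    note R = \<open>subgroup R AutT\<close> and R' = \<open>subgroup R AutT\<close>[unfolded subgroup_AutT_iff]
    obtain x where x: "x \<in> tree_auts" "x \<circ> ?u \<circ> inv\<^bsub>AutT\<^esub> x \<in> R"
      using less.prems unfolding conj_in_def by blast
    have tree: "?u \<in> tree_auts" "?v \<in> tree_auts"
      by simp_all
    have active: "root_perm ?u One = Two" "root_perm ?v One = Two"
      by (rule root_perm_sect_eqI; simp)+
    note g = x(2) root_perm_conj[OF x(1) tree(1) active(1)]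
    have uu: "root_perm (?u \<circ> ?u) One = One" "sect One (?u \<circ> ?u) = ?v"
      by (rule root_perm_sect_eqI; simp)+
    have dt: "root_perm (grig_d \<circ> grig_t) One = One" "sect One (grig_d \<circ> grig_t) = grig_b \<circ> grig_t"
      by (rule root_perm_sect_eqI; simp)+
    have "x \<circ> (?u \<circ> ?u) \<circ> inv\<^bsub>AutT\<^esub> x = (x \<circ> ?u \<circ> inv\<^bsub>AutT\<^esub> x) \<circ> (x \<circ> ?u \<circ> inv\<^bsub>AutT\<^esub> x)"
      using x(1) by (simp add: fun_eq_iff)
    then have "conj_in R (?u \<circ> ?u)"
      using x R' unfolding conj_in_def by metis
    then have v: "conj_in (sect_grp R) ?v"
      using conj_in_sect_grp[OF R g _ uu(1)] uu(2) by simp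
    have bt: "conj_in (sect_grp R) (grig_b \<circ> grig_t)"
      using conj_in_sect_grp[OF R g _ dt(1) less.prems(4)] dt(2) by simp
    have R1: "subgroup (sect_grp R) AutT" "finite (sect_grp R)"
      using R less.prems by (simp_all add: sect_grp_subgroup finite_sect_grp)
    obtain y where y: "y \<in> tree_auts" "y \<circ> ?v \<circ> inv\<^bsub>AutT\<^esub> y \<in> sect_grp R"
      using v unfolding conj_in_def by blast
    note h = y(2) root_perm_conj[OF y(1) tree(2) active(2)]
    \<comment> \<open>\<open>R\<close> and \<open>sect_grp R\<close> both contain an active element,
      so the order drops at each of the two levels.\<close>
    have "card (sect_grp (sect_grp R)) < card R"
      using card_sect_grp_less[OF R1(2) h] card_sect_grp_less[OF less.prems(1) g] by simp
    then show False
      by (rule less.hyps[OF _ finite_sect_grp[OF R1(2)] sect_grp_subgroup[OF R1(1)] conj_in_step[OF R1(1) h bt]])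
  qed
qed

text \<open>Three letters, because sections at \<open>Two\<close> run through the cycles
  \<open>b, c, d, b\<close> and \<open>t, bt, dt, t\<close>; this puts \<open>b\<close> and
  \<open>t\<close> into the subgroup.\<close>

definition stab_two :: "(vertex \<Rightarrow> vertex) set" where
  "stab_two = {h \<in> automaton_group ext_automaton. \<forall>w. h (Two # Two # Two # w) = Two # Two # Two # h w}"

lemma automaton_group_gens:
  "state_action ext_automaton ` states ext_automaton =
    {grig_t, grig_b \<circ> grig_t, grig_a \<circ> grig_b \<circ> grig_t, grig_d \<circ> grig_t}"
  using state_action_ext by (simp add: ext_automaton_def grig_t_def)

lemma automaton_group_closed:
  "subgroup (automaton_group ext_automaton) AutT"
  "\<And>g h. g \<in> automaton_group ext_automaton \<Longrightarrow> h \<in> automaton_group ext_automaton \<Longrightarrow>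
    g \<circ> h \<in> automaton_group ext_automaton"
  "\<And>g. g \<in> automaton_group ext_automaton \<Longrightarrow> inv\<^bsub>AutT\<^esub> g \<in> automaton_group ext_automaton"
  "automaton_group ext_automaton \<subseteq> tree_auts"
  using automaton_group_subgroup[OF invertible_ext_automaton] by (auto simp: subgroup_AutT_iff)

text \<open>\<open>b\<close>, \<open>d\<close> and \<open>a\<close> are the quotients of
  \<open>bt\<close> and \<open>dt\<close> by \<open>t\<close> and of \<open>abt\<close> by
  \<open>bt\<close>; finally \<open>c = bd\<close>.\<close>

lemma grig_in_automaton_group:
  "grig_t \<in> automaton_group ext_automaton"
  "{grig_a, grig_b, grig_c, grig_d} \<subseteq> automaton_group ext_automaton"
proof -
  let ?H = "automaton_group ext_automaton"
  have gens: "grig_t \<in> ?H" "grig_b \<circ> grig_t \<in> ?H" "grig_a \<circ> grig_b \<circ> grig_t \<in> ?H" "grig_d \<circ> grig_t \<in> ?H"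
    unfolding automaton_group_def automaton_group_gens by (auto intro: generate.incl)
  then show "grig_t \<in> ?H" by blast
  have cancel: "g \<in> ?H" if "g \<circ> h \<in> ?H" "h \<in> ?H" for g h
  proof -
    have "h \<in> tree_auts" using that automaton_group_closed(4) by blast
    then have "g = (g \<circ> h) \<circ> inv\<^bsub>AutT\<^esub> h" by (simp add: fun_eq_iff)
    then show ?thesis using that automaton_group_closed by metis
  qed
  have b: "grig_b \<in> ?H" and d: "grig_d \<in> ?H"
    using gens cancel by blast+
  moreover have "grig_a \<in> ?H"
    using gens cancel[of grig_a "grig_b \<circ> grig_t"] by (simp add: comp_assoc)
  moreover have "grig_b \<circ> grig_d = grig_c"
    by (simp add: fun_eq_iff)
  ultimately show "{grig_a, grig_b, grig_c, grig_d} \<subseteq> ?H"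
    using automaton_group_closed(2)[OF b d] by simp
qed

lemma stab_two_subgroup: "subgroup stab_two AutT"
proof -
  have "(inv\<^bsub>AutT\<^esub> h) (Two # Two # Two # w) = Two # Two # Two # (inv\<^bsub>AutT\<^esub> h) w" if "h \<in> stab_two" for h w
  proof -
    have h: "h \<in> tree_auts" using that automaton_group_closed(4) by (auto simp: stab_two_def)
    have "h (Two # Two # Two # (inv\<^bsub>AutT\<^esub> h) w) = Two # Two # Two # w"
      using that h by (simp add: stab_two_def)
    then show ?thesis using AutT_inv_apply(1)[OF h] by metis
  qed
  moreover have "id \<in> automaton_group ext_automaton"
    using automaton_group_closed(1) by (simp add: subgroup_AutT_iff)
  ultimately show ?thesis
    using automaton_group_closed unfolding subgroup_AutT_iff by (auto simp: stab_two_def)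
qed

text \<open>The sections of \<open>b\<close> and \<open>t\<close> at \<open>One\<close> are
  \<open>a\<close> and \<open>bt\<close>. As \<open>a\<close> is active, \<open>conj_in_step\<close>
  applies to them and yields conjugates of \<open>abt\<close> and \<open>dt\<close> on the second
  level.\<close>

lemma infinite_stab_two: "infinite stab_two"
proof
  assume fin: "finite stab_two"
  have "grig_b \<in> stab_two" "grig_t \<in> stab_two"
    using grig_in_automaton_group by (auto simp: stab_two_def)
  moreover have *: "root_perm grig_b One = One" "sect One grig_b = grig_a"
    "root_perm grig_t One = One" "sect One grig_t = grig_b \<circ> grig_t"
    by (rule root_perm_sect_eqI; simp)+
  ultimately have in1: "grig_a \<in> sect_grp stab_two" "grig_b \<circ> grig_t \<in> sect_grp stab_two"
    unfolding sect_grp_def by (metis (mono_tags, lifting) image_eqI mem_Collect_eq)+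
  have sub: "subgroup (sect_grp stab_two) AutT"
    using sect_grp_subgroup stab_two_subgroup by blast
  have "root_perm grig_a One = Two"
    by (simp add: root_perm_def)
  then show False
    using infinite_if_conj_in[OF sect_grp_subgroup[OF sub]] conj_in_step[OF sub in1(1) _ conj_inI[OF sub in1(2)]]
      finite_sect_grp fin by blast
qed

section \<open>Contraction of the Grigorchuk group\<close>

definition nucleus :: "(vertex \<Rightarrow> vertex) set" where
  "nucleus = {id, grig_a, grig_b, grig_c, grig_d}"

text \<open>The contraction step: one level suffices to bring a product of two nucleus elements back
  into the nucleus. With \<open>n = id\<close> it gives closure of the nucleus under
  sections.\<close>

lemma nucleus_comp_Cons:
  assumes "m \<in> nucleus" "n \<in> nucleus"
  shows "\<exists>y. \<exists>k\<in>nucleus. \<forall>w. m (n (x # w)) = y # k w"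
  using assms by (cases x) (auto simp: nucleus_def)

lemma nucleus_append:
  assumes "m \<in> nucleus"
  shows "\<exists>v'. \<exists>k\<in>nucleus. length v' = length v \<and> (\<forall>w. m (v @ w) = v' @ k w)"
  using assms
proof (induction v arbitrary: m)
  case (Cons x v)
  have "id \<in> nucleus"
    by (simp add: nucleus_def)
  from nucleus_comp_Cons[OF Cons.prems this]
  obtain y k where k: "k \<in> nucleus" "\<And>w. m (x # w) = y # k w"
    by (metis id_apply)
  obtain v' k' where "k' \<in> nucleus" "length v' = length v" "\<And>w. k (v @ w) = v' @ k' w"
    using Cons.IH[OF k(1)] by blast
  then show ?case
    using k by (intro exI[of _ "y # v'"] bexI[of _ k']) auto
qed auto

lemma contracting:
  assumes "g \<in> grigorchuk_group"
  shows "\<exists>L. \<forall>v. length v \<ge> L \<longrightarrow>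
    (\<exists>v'. \<exists>k\<in>nucleus. length v' = length v \<and> (\<forall>w. g (v @ w) = v' @ k w))"
  using assms unfolding grigorchuk_group_def
proof (induction rule: generate.induct)
  case one
  then show ?case
    using nucleus_append[of id] by (auto simp: nucleus_def)
next
  case (incl h)
  then show ?case
    using nucleus_append[of h] by (auto simp: nucleus_def)
next
  case (inv h)
  then have "h \<in> nucleus" "h \<in> tree_auts" "h \<circ> h = id"
    by (auto simp: nucleus_def)
  then have "inv\<^bsub>AutT\<^esub> h = h" "h \<in> nucleus"
    by (auto intro: AutT_inv_unique)
  then show ?case
    using nucleus_append[of h] by auto
next
  case (eng g h)
  obtain L where L: "\<And>v. length v \<ge> L \<Longrightarrow>
    \<exists>v'. \<exists>k\<in>nucleus. length v' = length v \<and> (\<forall>w. g (v @ w) = v' @ k w)"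
    using eng.IH(1) by blast
  obtain M where M: "\<And>v. length v \<ge> M \<Longrightarrow>
    \<exists>v'. \<exists>k\<in>nucleus. length v' = length v \<and> (\<forall>w. h (v @ w) = v' @ k w)"
    using eng.IH(2) by blast
  have "\<exists>v'. \<exists>k\<in>nucleus. length v' = length v \<and> (\<forall>w. (g \<circ> h) (v @ w) = v' @ k w)"
    \<comment> \<open>Beyond both bounds the section is a product of two nucleus elements; the extra
      level reduces it to one.\<close>
    if v: "length v \<ge> Suc (max L M)" for v
  proof -
    obtain u x where u: "v = u @ [x]"
      using v by (cases v rule: rev_cases) auto
    obtain u' m where u': "m \<in> nucleus" "length u' = length u" "\<And>w. h (u @ w) = u' @ m w"
      using M[of u] v u by auto
    obtain u'' n where u'': "n \<in> nucleus" "length u'' = length u'" "\<And>w. g (u' @ w) = u'' @ n w"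
      using L[of u'] v u u' by auto
    obtain y k where "k \<in> nucleus" "\<And>w. n (m (x # w)) = y # k w"
      using nucleus_comp_Cons[OF u''(1) u'(1)] by blast
    then show ?thesis
      using u u' u'' by (intro exI[of _ "u'' @ [y]"] bexI[of _ k]) auto
  qed
  then show ?case
    by auto
qed

lemma stab_two_inter_grigorchuk: "stab_two \<inter> grigorchuk_group \<subseteq> nucleus"
proof
  fix g assume g: "g \<in> stab_two \<inter> grigorchuk_group"
  obtain L where L: "\<And>v. length v \<ge> L \<Longrightarrow>
    \<exists>v'. \<exists>k\<in>nucleus. length v' = length v \<and> (\<forall>w. g (v @ w) = v' @ k w)"
    using contracting g by blast
  \<comment> \<open>Powers of the word \<open>222\<close> serve as \<open>v\<close>:
    \<open>g\<close> equals its section at each of them.\<close>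
  have "\<exists>v. length v \<ge> n \<and> (\<forall>w. g (v @ w) = v @ g w)" for n
  proof (induction n)
    case (Suc n)
    then obtain v where "length v \<ge> n" "\<And>w. g (v @ w) = v @ g w"
      by blast
    then show ?case
      using g by (intro exI[of _ "Two # Two # Two # v"]) (simp add: stab_two_def)
  qed (simp add: exI[of _ "[]"])
  then obtain v where v: "length v \<ge> L" "\<And>w. g (v @ w) = v @ g w"
    by blast
  then obtain v' k where "k \<in> nucleus" "length v' = length v" "\<And>w. g (v @ w) = v' @ k w"
    using L by blast
  then have "g = k"
    using v(2) by (auto simp: fun_eq_iff)
  then show "g \<in> nucleus"
    using \<open>k \<in> nucleus\<close> by simp
qed

text \<open>Pigeonhole: with finitely many cosets, one would contain infinitely many
  \<open>q\<close> from \<open>stab_two\<close>. Quotients of two such elements lie in the nucleus,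
  which is finite.\<close>

lemma infinite_rcosets:
  "infinite (rcosets\<^bsub>AutT\<lparr>carrier := automaton_group ext_automaton\<rparr>\<^esub> grigorchuk_group)"
proof
  let ?A = "AutT\<lparr>carrier := automaton_group ext_automaton\<rparr>"
  let ?f = "\<lambda>p. grigorchuk_group #>\<^bsub>?A\<^esub> p"
  assume "finite (rcosets\<^bsub>?A\<^esub> grigorchuk_group)"
  moreover have "?f ` stab_two \<subseteq> rcosets\<^bsub>?A\<^esub> grigorchuk_group"
    by (auto simp: RCOSETS_def stab_two_def)
  ultimately have "finite (?f ` stab_two)"
    by (rule finite_subset[rotated])
  then obtain p where p: "p \<in> stab_two" "infinite {q \<in> stab_two. ?f q = ?f p}"
    using pigeonhole_infinite[OF infinite_stab_two] by blast
  note stab = stab_two_subgroup[unfolded subgroup_AutT_iff]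
  have "{q \<in> stab_two. ?f q = ?f p} \<subseteq> (\<lambda>g. g \<circ> p) ` nucleus"
  proof safe
    fix q assume q: "q \<in> stab_two" "?f q = ?f p"
    have "q \<in> ?f q"
      using grigorchuk_group_subgroup
      by (auto simp: r_coset_def subgroup_AutT_iff intro!: bexI[of _ id])
    then obtain g where g: "g \<in> grigorchuk_group" "q = g \<circ> p"
      using q by (auto simp: r_coset_def)
    have "p \<in> tree_auts"
      using p stab by blast
    then have "g = q \<circ> inv\<^bsub>AutT\<^esub> p"
      using g by (simp add: fun_eq_iff)
    then have "g \<in> stab_two"
      using p q stab by blast
    then show "q \<in> (\<lambda>g. g \<circ> p) ` nucleus"
      using g stab_two_inter_grigorchuk by blast
  qed
  moreover have "finite ((\<lambda>g. g \<circ> p) ` nucleus)"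
    by (simp add: nucleus_def)
  ultimately show False
    using p(2) by (rule finite_subset[THEN notE[rotated]])
qed

section \<open>Approximation by elements of the Grigorchuk group\<close>

text \<open>Words instead of group elements, so that the substitutions below are plain recursions
  and no relations have to be checked.\<close>

datatype grig_gen = GA | GB | GC | GD

fun gen_val :: "grig_gen \<Rightarrow> vertex \<Rightarrow> vertex" where
  "gen_val GA = grig_a"
| "gen_val GB = grig_b"
| "gen_val GC = grig_c"
| "gen_val GD = grig_d"

fun word_val :: "grig_gen list \<Rightarrow> vertex \<Rightarrow> vertex" where
  "word_val [] v = v"
| "word_val (x # w) v = gen_val x (word_val w v)"

lemma word_val_append [simp]: "word_val (w @ w') v = word_val w (word_val w' v)"
  by (induction w) auto

lemma word_val_Nil [simp]: "word_val w [] = []"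
proof (induction w)
  case (Cons x w)
  then show ?case by (cases x) auto
qed simp

lemma word_val_in_grigorchuk: "word_val w \<in> grigorchuk_group"
proof (induction w)
  case Nil
  have "word_val [] = id" by (simp add: fun_eq_iff)
  then show ?case
    using grigorchuk_group_subgroup by (metis subgroup_AutT_iff)
next
  case (Cons x w)
  have "gen_val x \<in> grigorchuk_group"
    unfolding grigorchuk_group_def by (cases x) (auto intro: generate.incl)
  moreover have "word_val (x # w) = gen_val x \<circ> word_val w"
    by (simp add: fun_eq_iff)
  ultimately show ?case
    using grigorchuk_group_subgroup Cons.IH by (metis subgroup_AutT_iff)
qed

text \<open>Lysenok's substitution: in the group, \<open>lift_word w = (first_word w, w)\<close>, with \<open>first_word w\<close> in
  the dihedral group \<open>\<langle>a, d\<rangle>\<close> of order 8.\<close>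

fun lift_word :: "grig_gen list \<Rightarrow> grig_gen list" where
  "lift_word [] = []"
| "lift_word (GA # w) = GA # GC # GA # lift_word w"
| "lift_word (GB # w) = GD # lift_word w"
| "lift_word (GC # w) = GB # lift_word w"
| "lift_word (GD # w) = GC # lift_word w"

fun first_word :: "grig_gen list \<Rightarrow> grig_gen list" where
  "first_word [] = []"
| "first_word (GA # w) = GD # first_word w"
| "first_word (GB # w) = first_word w"
| "first_word (GC # w) = GA # first_word w"
| "first_word (GD # w) = GA # first_word w"

lemma lift_word_append [simp]: "lift_word (w @ w') = lift_word w @ lift_word w'"
  by (induction w rule: lift_word.induct) auto

lemma first_word_append [simp]: "first_word (w @ w') = first_word w @ first_word w'"
  by (induction w rule: first_word.induct) auto

text \<open>Letter by letter: \<open>aca = (d, a)\<close>, \<open>d = (1, b)\<close>,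
  \<open>b = (a, c)\<close>, \<open>c = (a, d)\<close>.\<close>

lemma word_val_lift [simp]:
  "word_val (lift_word w) (One # v) = One # word_val (first_word w) v"
  "word_val (lift_word w) (Two # v) = Two # word_val w v"
  by (induction w rule: lift_word.induct) auto

text \<open>The square of \<open>ad\<close> is \<open>(b, b)\<close>, and \<open>b\<close> is an
  involution.\<close>

lemma grig_ad_order [simp]:
  "grig_a (grig_d (grig_a (grig_d (grig_a (grig_d (grig_a (grig_d v))))))) = v"
  "grig_d (grig_a (grig_d (grig_a (grig_d (grig_a (grig_d (grig_a v))))))) = v"
  by (cases v; cases "hd v"; simp add: neq_Nil_conv)+

text \<open>The composite sends \<open>b\<close> and \<open>c\<close> to \<open>a\<close>,
  \<open>d\<close> to the empty word, and \<open>a\<close> to \<open>daddad = 1\<close>, so its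
  values lie in a group of order two.\<close>

lemma first_lift_lift:
  "(\<forall>v. word_val (first_word (lift_word (lift_word w))) v = v) \<or>
   (\<forall>v. word_val (first_word (lift_word (lift_word w))) v = grig_a v)"
  by (induction w rule: lift_word.induct) auto

text \<open>If the first coordinate of \<open>lift_word (b w)\<close> is \<open>z = (ad)\<^sup>2\<close>, then its product with its conjugate by
  \<open>a\<close> is \<open>(z b w, b w z)\<close>; the central factor \<open>(ac)\<^sup>4 = (z, z)\<close> turns this into \<open>(b w, b w)\<close>.\<close>

fun approx_word :: "nat \<Rightarrow> grig_gen list" where
  "approx_word 0 = [GA, GC, GA, GC]"
| "approx_word (Suc n) = lift_word (GB # approx_word n) @ [GA, GC, GA, GC, GA, GC, GA, GC]
     @ [GA] @ lift_word (GB # approx_word n) @ [GA]"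

text \<open>By the second conjunct, the first coordinate of \<open>lift_word (b w)\<close> is
  \<open>z\<close>'s counterpart \<open>a\<close> under \<open>first_word\<close>, so the new first
  conjunct reads \<open>a d a d\<close>. The new second one reads \<open>x dad x dad\<close> with
  \<open>x\<close> in \<open>{1, a}\<close> from \<open>first_lift_lift\<close>, which is trivial as
  \<open>ad\<close> has order dividing 4.\<close>

lemma approx_word_invariant:
  "word_val (first_word (approx_word n)) v = grig_a (grig_d (grig_a (grig_d v))) \<and>
   word_val (first_word (lift_word (approx_word n))) v = v"
proof (induction n arbitrary: v)
  case 0
  have "grig_d (grig_a (grig_d (grig_a v))) = grig_a (grig_d (grig_a (grig_d v)))"
    by (metis grig_ad_order(2) grig_invol(1,4))
  then show ?case by simp
next
  case (Suc n)
  show ?case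
    using Suc first_lift_lift[of "approx_word n"] by auto
qed

lemma approx_word_Cons:
  "word_val (approx_word (Suc n)) (x # v) = x # grig_b (word_val (approx_word n) v)"
  using approx_word_invariant[of n] by (cases x) simp_all

lemma approx_word: "length v \<le> n \<Longrightarrow> word_val (approx_word n) v = grig_t v"
proof (induction n arbitrary: v)
  case 0
  then show ?case by simp
next
  case (Suc n)
  then show ?case
    by (cases v) (simp_all add: approx_word_Cons del: approx_word.simps)
qed

section \<open>Closures as approximation on every level\<close>

lemma in_closure_of_aut_iff:
  assumes "S \<subseteq> tree_auts"
  shows "g \<in> aut_topology closure_of S \<longleftrightarrow>
    g \<in> tree_auts \<and> (\<forall>n. \<exists>h\<in>S. \<forall>w. length w = n \<longrightarrow> h w = g w)"
proof safe
  assume g: "g \<in> aut_topology closure_of S"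
  then show gT: "g \<in> tree_auts"
    by (simp add: in_closure_of topspace_aut_topology)
  fix n
  define T where "T = {h \<in> tree_auts. \<forall>w. length w = n \<longrightarrow> h w = g w}"
  have "openin aut_topology T"
    unfolding openin_aut_topology
    by (auto simp: T_def l_coset_def level_stabilizer_def intro!: exI[of _ n])
  moreover have "g \<in> T"
    using gT by (simp add: T_def)
  ultimately obtain h where "h \<in> S" "h \<in> T"
    using g unfolding in_closure_of by blast
  then show "\<exists>h\<in>S. \<forall>w. length w = n \<longrightarrow> h w = g w"
    by (auto simp: T_def)
next
  assume g: "g \<in> tree_auts" and approx: "\<forall>n. \<exists>h\<in>S. \<forall>w. length w = n \<longrightarrow> h w = g w"
  have "\<exists>h. h \<in> S \<and> h \<in> U" if U: "g \<in> U" "openin aut_topology U" for U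
  proof -
    obtain n where n: "g <#\<^bsub>AutT\<^esub> level_stabilizer n \<subseteq> U"
      using U openin_aut_topology by blast
    obtain h where h: "h \<in> S" "\<And>w. length w = n \<Longrightarrow> h w = g w"
      using approx by blast
    have "inv\<^bsub>AutT\<^esub> g \<circ> h \<in> level_stabilizer n" 
      using h g assms by (auto simp: level_stabilizer_def)
    moreover have "h = g \<circ> (inv\<^bsub>AutT\<^esub> g \<circ> h)"
      using g by (simp add: fun_eq_iff)
    ultimately have "h \<in> g <#\<^bsub>AutT\<^esub> level_stabilizer n"
      unfolding l_coset_def by force
    then show ?thesis using h n by blast
  qed
  then show "g \<in> aut_topology closure_of S"
    using g by (simp add: in_closure_of topspace_aut_topology)
qed

text \<open>Each generator is a word in \<open>a, b, d\<close> followed on the right by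
  \<open>t\<close>, and \<open>approx_word n\<close> replaces \<open>t\<close> on level
  \<open>n\<close>.\<close>

lemma state_action_approx:
  assumes "h \<in> {grig_t, grig_b \<circ> grig_t, grig_a \<circ> grig_b \<circ> grig_t, grig_d \<circ> grig_t}"
  shows "\<exists>g\<in>grigorchuk_group. \<forall>w. length w = n \<longrightarrow> g w = h w"
proof -
  have "h = word_val [] \<circ> grig_t \<or> h = word_val [GB] \<circ> grig_t \<or> h = word_val [GA, GB] \<circ> grig_t
      \<or> h = word_val [GD] \<circ> grig_t"
    using assms by (auto simp: fun_eq_iff)
  then obtain u where "h = word_val u \<circ> grig_t"
    by blast
  then show ?thesis
    by (intro bexI[of _ "word_val (u @ approx_word n)"]) (simp_all add: approx_word word_val_in_grigorchuk)
qed

text \<open>Agreement on level \<open>n\<close> passes to products and inverses because tree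
  automorphisms preserve levels.\<close>

lemma automaton_group_approx:
  assumes "h \<in> automaton_group ext_automaton"
  shows "\<exists>g\<in>grigorchuk_group. \<forall>w. length w = n \<longrightarrow> g w = h w"
  using assms unfolding automaton_group_def automaton_group_gens
proof (induction rule: generate.induct)
  case one
  then show ?case
    using grigorchuk_group_subgroup by (intro bexI[of _ id]) (auto simp: subgroup_AutT_iff)
next
  case (incl h)
  then show ?case
    by (rule state_action_approx)
next
  case (inv h)
  then have h: "h \<in> tree_auts"
    by auto
  obtain g where g: "g \<in> grigorchuk_group" "\<And>w. length w = n \<Longrightarrow> g w = h w"
    using state_action_approx[OF inv] by blast
  have gT: "g \<in> tree_auts" "inv\<^bsub>AutT\<^esub> g \<in> grigorchuk_group"
    using g grigorchuk_group_subgroup by (auto simp: subgroup_AutT_iff)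
  have "(inv\<^bsub>AutT\<^esub> g) w = (inv\<^bsub>AutT\<^esub> h) w" if "length w = n" for w
  proof -
    have "g ((inv\<^bsub>AutT\<^esub> h) w) = w"
      using g(2)[of "(inv\<^bsub>AutT\<^esub> h) w"] h that by simp
    then show ?thesis
      using AutT_inv_apply(1)[OF gT(1)] by metis
  qed
  then show ?case using gT by blast
next
  case (eng h1 h2)
  obtain g1 g2 where g: "g1 \<in> grigorchuk_group" "\<And>w. length w = n \<Longrightarrow> g1 w = h1 w"
    "g2 \<in> grigorchuk_group" "\<And>w. length w = n \<Longrightarrow> g2 w = h2 w"
    using eng.IH by blast
  have "g2 \<in> tree_auts" "g1 \<circ> g2 \<in> grigorchuk_group"
    using g grigorchuk_group_subgroup by (auto simp: subgroup_AutT_iff)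
  then show ?case
    using g by (intro bexI[of _ "g1 \<circ> g2"]) (auto, metis tree_auts_length)
qed

lemma grigorchuk_subset: "grigorchuk_group \<subseteq> automaton_group ext_automaton"
  unfolding grigorchuk_group_def
  by (rule AutT.generate_subgroup_incl[OF grig_in_automaton_group(2) automaton_group_closed(1)])

lemma closure_eq:
  "aut_topology closure_of automaton_group ext_automaton = aut_topology closure_of grigorchuk_group"
proof
  show "aut_topology closure_of grigorchuk_group \<subseteq> aut_topology closure_of automaton_group ext_automaton"
    by (rule closure_of_mono[OF grigorchuk_subset])
  show "aut_topology closure_of automaton_group ext_automaton \<subseteq> aut_topology closure_of grigorchuk_group"
  proof
    fix g assume "g \<in> aut_topology closure_of automaton_group ext_automaton"
    then have g: "g \<in> tree_auts"
      "\<And>n. \<exists>h\<in>automaton_group ext_automaton. \<forall>w. length w = n \<longrightarrow> h w = g w"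
      by (simp_all add: in_closure_of_aut_iff automaton_group_closed(4))
    have "\<exists>h\<in>grigorchuk_group. \<forall>w. length w = n \<longrightarrow> h w = g w" for n
    proof -
      obtain h where h: "h \<in> automaton_group ext_automaton" "\<And>w. length w = n \<Longrightarrow> h w = g w"
        using g(2) by blast
      then show ?thesis
        using automaton_group_approx[OF h(1), of n] by simp
    qed
    moreover have "grigorchuk_group \<subseteq> tree_auts"
      using grigorchuk_group_subgroup by (simp add: subgroup_AutT_iff)
    ultimately show "g \<in> aut_topology closure_of grigorchuk_group"
      using g(1) by (simp add: in_closure_of_aut_iff)
  qed
qed

theorem corollary8:
  shows "\<exists>A :: nat automaton.
    invertible_automaton A \<and> card (states A) = 4 \<and>
    subgroup grigorchuk_group (AutT\<lparr>carrier := automaton_group A\<rparr>) \<and>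
    infinite (rcosets\<^bsub>AutT\<lparr>carrier := automaton_group A\<rparr>\<^esub> grigorchuk_group) \<and>
    aut_topology closure_of automaton_group A = aut_topology closure_of grigorchuk_group"
proof (intro exI conjI)
  show "subgroup grigorchuk_group (AutT\<lparr>carrier := automaton_group ext_automaton\<rparr>)"
    by (rule AutT.subgroup_incl[OF grigorchuk_group_subgroup automaton_group_closed(1) grigorchuk_subset])
  show "card (states ext_automaton) = 4"
    by (simp add: ext_automaton_def)
qed (fact invertible_ext_automaton infinite_rcosets closure_eq)+

end
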